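(* For every integer $k\ge 2$ there exists a DAG $G$ and an execution of the greedy chain algorithm on $G$ such that the $k$ chains it selects cover at most $\frac{3}{4}\beta_k$ vertices. Likewise, for every integer $k\ge 2$ there exists a DAG $G$ and an execution of the greedy antichain algorithm on $G$ such that the $k$ antichains it selects cover at most $\frac{3}{4}\alpha_k$ vertices.
   Context: Let $G=(V,E)$ be a directed acyclic graph. A chain is a set of vertices that occur, in order, as a subsequence of the vertices of some directed path of $G$. An antichain is a set of vertices that are pairwise unreachable from one another. $\alpha_k$ (resp. $\beta_k$) is the maximum size of the union of $k$ pairwise disjoint antichains (resp. chains) of $G$. The greedy chain algorithm run for $k$ steps maintains the set $U$ of uncovered vertices (initially $U=V$) and in each of $k$ iterations selects a chain $C\subseteq U$ of maximum size (ties broken arbitrarily) and removes $C$ from $U$; the greedy antichain algorithm is identical with antichains in place of chains. (This is the greedy algorithm for maximum coverage with the chains, resp. antichains, of $G$ as the sets.) *)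

theory Defs
  imports "Graph_Theory.Graph_Theory" "HOL-Library.Sublist" "HOL-Library.Disjoint_Sets"
begin

text \<open>
  The vertex set of a DAG is finite and nonempty; without nonemptiness the empty graph, on which
  every greedy run and every optimum covers 0 vertices, would satisfy any approximation bound.
\<close>

definition dag :: "'a pair_pre_digraph \<Rightarrow> bool" where
  "dag G \<longleftrightarrow> pair_fin_digraph G \<and> pverts G \<noteq> {} \<and> acyclic (parcs G)"

definition dag_chain :: "'a pair_pre_digraph \<Rightarrow> 'a set \<Rightarrow> bool" where
  "dag_chain G C \<longleftrightarrow> (\<exists>p xs. vpath p (with_proj G) \<and> subseq xs p \<and> C = set xs)"

definition dag_antichain :: "'a pair_pre_digraph \<Rightarrow> 'a set \<Rightarrow> bool" where
  "dag_antichain G A \<longleftrightarrow> A \<subseteq> pverts G \<and>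
     (\<forall>u\<in>A. \<forall>v\<in>A. u \<noteq> v \<longrightarrow> \<not> u \<rightarrow>\<^sup>*\<^bsub>with_proj G\<^esub> v)"

text \<open>
  The empty set is a chain and an antichain, so families of \<open>k\<close> disjoint (anti)chains exist
  for every \<open>k\<close>, also when \<open>k\<close> exceeds the number of vertices.
\<close>

definition max_disjoint_union :: "('a set \<Rightarrow> bool) \<Rightarrow> nat \<Rightarrow> nat" where
  "max_disjoint_union P k =
     Max {card (\<Union>i<k. S i) | S. (\<forall>i<k. P (S i)) \<and> disjoint_family_on S {..<k}}"

definition alpha :: "'a pair_pre_digraph \<Rightarrow> nat \<Rightarrow> nat" where
  "alpha G k = max_disjoint_union (dag_antichain G) k"

definition beta :: "'a pair_pre_digraph \<Rightarrow> nat \<Rightarrow> nat" where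
  "beta G k = max_disjoint_union (dag_chain G) k"

text \<open>
  \<open>greedy_run P U Ss\<close>: started with the set \<open>U\<close> of uncovered vertices, the greedy algorithm
  can select, for some way of breaking ties, the sets in the list \<open>Ss\<close>, in this order.
\<close>

inductive greedy_run :: "('a set \<Rightarrow> bool) \<Rightarrow> 'a set \<Rightarrow> 'a set list \<Rightarrow> bool" for P where
  "greedy_run P U []"
| "is_arg_max card (\<lambda>S. P S \<and> S \<subseteq> U) S \<Longrightarrow> greedy_run P (U - S) Ss \<Longrightarrow> greedy_run P U (S # Ss)"

definition greedy_chain_run :: "'a pair_pre_digraph \<Rightarrow> nat \<Rightarrow> 'a set list \<Rightarrow> bool" where
  "greedy_chain_run G k Cs \<longleftrightarrow> length Cs = k \<and> greedy_run (dag_chain G) (pverts G) Cs"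

definition greedy_antichain_run :: "'a pair_pre_digraph \<Rightarrow> nat \<Rightarrow> 'a set list \<Rightarrow> bool" where
  "greedy_antichain_run G k As \<longleftrightarrow> length As = k \<and> greedy_run (dag_antichain G) (pverts G) As"

end

theory Submission
  imports Defs
begin

text \<open>
  For a permutation, the points with order ``smaller position and smaller value'' form a poset
  whose chains are the increasing subsequences, and the points with order ``smaller position and
  larger value'' form a poset whose antichains are the increasing subsequences. So it suffices to
  find permutations on which greedily removing longest increasing subsequences is bad.

  In 3 4 7 8 1 2 5 6 greedy may take 3 4 5 6 and then 7 8, while 3 4 7 8 and 1 2 5 6 cover
  everything: 6 against 8 in two steps. In 8 9 4 5 10 0 1 6 11 7 2 3 greedy may take 0 1 6 11, then
  4 5 10, then 8 9, while 8 9 10 11, 4 5 6 7 and 0 1 2 3 cover everything: 9 against 12 in three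
  steps. In a skew sum of such blocks (each block lying below the previous ones) every increasing
  subsequence stays inside one block, and greedy may treat the blocks in parallel. Copies of the
  first block, together with one copy of the second block if \<open>k\<close> is odd, give the ratio 3/4.
\<close>

section \<open>Greedy runs and disjoint families\<close>

text \<open>Disjoint sets of the current maximum size \<open>h\<close> can be selected in any order:
  removing one leaves the others intact, and \<open>h\<close> still bounds what remains. So one
  application handles a whole phase of equally large selections.\<close>

lemma greedy_run_append:
  assumes "sorted_wrt disjnt Ss" "\<And>S. S \<in> set Ss \<Longrightarrow> P S \<and> S \<subseteq> U \<and> card S = h"
    and "\<And>S. P S \<Longrightarrow> S \<subseteq> U \<Longrightarrow> card S \<le> h"
    and "greedy_run P (U - \<Union>(set Ss)) Ts"
  shows "greedy_run P U (Ss @ Ts)"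
  using assms
proof (induction Ss arbitrary: U)
  case (Cons S Ss)
  have "greedy_run P (U - S) (Ss @ Ts)"
  proof (rule Cons.IH)
    show "P S' \<and> S' \<subseteq> U - S \<and> card S' = h" if "S' \<in> set Ss" for S'
      using Cons.prems(1) Cons.prems(2)[of S'] that by (auto simp: disjnt_iff)
    show "greedy_run P (U - S - \<Union> (set Ss)) Ts"
      using Cons.prems(4) by (simp add: Diff_eq Int_assoc)
    show "card S' \<le> h" if "P S'" "S' \<subseteq> U - S" for S'
      using that by (intro Cons.prems(3)) auto
  qed (use Cons.prems in auto)
  moreover have "is_arg_max card (\<lambda>S. P S \<and> S \<subseteq> U) S"
    using Cons.prems(2)[of S] Cons.prems(3) by (fastforce simp: is_arg_max_linorder)
  ultimately show ?case
    by (auto intro: greedy_run.intros)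
qed simp

lemma card_Union_sorted_wrt_disjnt:
  assumes "sorted_wrt disjnt Ss" "\<And>S. S \<in> set Ss \<Longrightarrow> finite S"
  shows "card (\<Union>(set Ss)) = sum_list (map card Ss)"
  using assms
proof (induction Ss)
  case (Cons S Ss)
  then have "S \<inter> \<Union>(set Ss) = {}"
    by (auto simp: disjnt_iff)
  with Cons show ?case
    by (simp add: card_Un_disjoint)
qed simp

lemma card_Union_le_max_disjoint_union:
  assumes "finite V" "\<And>S. P S \<Longrightarrow> S \<subseteq> V"
    and "sorted_wrt disjnt Ss" "\<And>S. S \<in> set Ss \<Longrightarrow> P S" "length Ss = k"
  shows "card (\<Union>(set Ss)) \<le> max_disjoint_union P k"
  unfolding max_disjoint_union_def
proof (rule Max_ge)
  show "finite {card (\<Union>i<k. S i) |S. (\<forall>i<k. P (S i)) \<and> disjoint_family_on S {..<k}}"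
  proof (rule finite_subset)
    show "{card (\<Union>i<k. S i) |S. (\<forall>i<k. P (S i)) \<and> disjoint_family_on S {..<k}} \<subseteq> {..card V}"
      using assms(1,2) by (auto intro!: card_mono)
  qed simp
  have "disjoint_family_on ((!) Ss) {..<k}"
    unfolding disjoint_family_on_def
  proof (intro ballI impI)
    fix m n assume "m \<in> {..<k}" "n \<in> {..<k}" "m \<noteq> n"
    then show "Ss ! m \<inter> Ss ! n = {}"
      using assms(3,5)
      by (cases m n rule: linorder_cases) (auto simp: sorted_wrt_iff_nth_less disjnt_def Int_commute)
  qed
  moreover have "(\<Union>i<k. Ss ! i) = \<Union>(set Ss)"
    using assms(5) by (fastforce simp: in_set_conv_nth)
  ultimately show "card (\<Union>(set Ss)) \<in>
      {card (\<Union>i<k. S i) |S. (\<forall>i<k. P (S i)) \<and> disjoint_family_on S {..<k}}"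
    using assms(4,5) by (auto intro!: exI[of _ "(!) Ss"])
qed

text \<open>A rank that grows along the order is injective on every increasing set. A table of ranks
  below \<open>h\<close> is thus a checkable certificate that no such set has more than
  \<open>h\<close> elements.\<close>

lemma card_le_rank_bound:
  fixes rk :: "'a::linorder \<Rightarrow> nat"
  assumes "strict_mono_on S f" "S \<subseteq> U"
    and "\<And>u v. u \<in> U \<Longrightarrow> v \<in> U \<Longrightarrow> u < v \<Longrightarrow> f u < f v \<Longrightarrow> rk u < rk v"
    and "\<And>v. v \<in> U \<Longrightarrow> rk v < h"
  shows "card S \<le> h"
proof -
  have "strict_mono_on S rk"
    using assms(1-3) by (auto simp: strict_mono_on_def subset_iff)
  then have "inj_on rk S"
    by (rule strict_mono_on_imp_inj_on)
  moreover have "rk ` S \<subseteq> {..<h}"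
    using assms(2,4) by auto
  ultimately have "card S \<le> card {..<h}"
    by (intro card_inj_on_le) auto
  then show ?thesis
    by simp
qed

section \<open>Chains and antichains of transitively closed graphs\<close>

lemma sorted_wrt_subseq: "subseq xs ys \<Longrightarrow> sorted_wrt R ys \<Longrightarrow> sorted_wrt R xs"
proof (induction rule: list_emb.induct)
  case (list_emb_Cons2 x y xs ys)
  then show ?case
    using list_emb_set[OF list_emb_Cons2.hyps(2)] by fastforce
qed auto

lemma vwalk_arcs_subset_if_sorted_wrt:
  "sorted_wrt (\<lambda>u v. (u, v) \<in> r) p \<Longrightarrow> set (vwalk_arcs p) \<subseteq> r"
  by (induction p rule: vwalk_arcs.induct) auto

lemma sorted_wrt_if_vwalk_arcs_subset:
  assumes "trans r"
  shows "set (vwalk_arcs p) \<subseteq> r \<Longrightarrow> sorted_wrt (\<lambda>u v. (u, v) \<in> r) p"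
proof (induction p rule: vwalk_arcs.induct)
  case (3 x y xs)
  then show ?case
    using transD[OF assms] by auto
qed auto

context
  fixes V :: "nat set" and r :: "nat rel"
  assumes fin: "finite V" and ne: "V \<noteq> {}" and r_V: "r \<subseteq> V \<times> V"
    and less: "\<And>u v. (u, v) \<in> r \<Longrightarrow> u < v" and tr: "trans r"
begin

lemma dag_pair_digraph: "dag \<lparr>pverts = V, parcs = r\<rparr>"
proof -
  have "finite r"
    using r_V fin by (auto intro: finite_subset)
  moreover have "acyclic r"
    unfolding acyclic_def trancl_id[OF tr] using less by blast
  ultimately show ?thesis
    using r_V fin ne by (auto simp: dag_def intro!: pair_fin_digraph.intro pair_wf_digraph.intro
        pair_fin_digraph_axioms.intro)
qed

text \<open>Transitivity turns the consecutive arcs of a path into arcs between all its pairs.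
  Conversely, the numbering is a topological order, so listing \<open>C\<close> in ascending order
  gives a path.\<close>

lemma dag_chain_pair_digraph:
  "dag_chain \<lparr>pverts = V, parcs = r\<rparr> C \<longleftrightarrow> C \<subseteq> V \<and> (\<forall>u\<in>C. \<forall>v\<in>C. u < v \<longrightarrow> (u, v) \<in> r)"
proof
  assume "dag_chain \<lparr>pverts = V, parcs = r\<rparr> C"
  then obtain p xs where p: "set p \<subseteq> V" "set (vwalk_arcs p) \<subseteq> r" and xs: "subseq xs p" "C = set xs"
    by (auto simp: dag_chain_def vpath_def vwalk_def)
  have "sorted_wrt (\<lambda>u v. (u, v) \<in> r) p"
    using sorted_wrt_if_vwalk_arcs_subset[OF tr p(2)] .
  then have srt: "sorted_wrt (\<lambda>u v. (u, v) \<in> r) xs"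
    using xs(1) by (auto intro: sorted_wrt_subseq)
  have "(u, v) \<in> r" if uv: "u \<in> C" "v \<in> C" "u < v" for u v
  proof -
    obtain i j where ij: "i < length xs" "j < length xs" "u = xs ! i" "v = xs ! j"
      using uv xs(2) by (auto simp: in_set_conv_nth)
    \<comment> \<open>If \<open>v\<close> came before \<open>u\<close> in \<open>xs\<close>, then
      \<open>(v, u) \<in> r\<close> and hence \<open>v < u\<close>, a contradiction.\<close>
    then show ?thesis
      using srt uv(3) less[of v u]
      by (cases i j rule: linorder_cases) (auto simp: sorted_wrt_iff_nth_less)
  qed
  moreover have "C \<subseteq> V"
    using p(1) xs by (auto dest: list_emb_set)
  ultimately show "C \<subseteq> V \<and> (\<forall>u\<in>C. \<forall>v\<in>C. u < v \<longrightarrow> (u, v) \<in> r)"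
    by blast
next
  assume C: "C \<subseteq> V \<and> (\<forall>u\<in>C. \<forall>v\<in>C. u < v \<longrightarrow> (u, v) \<in> r)"
  show "dag_chain \<lparr>pverts = V, parcs = r\<rparr> C"
  proof (cases "C = {}")
    case True
    \<comment> \<open>Paths are nonempty, so the empty chain is realised as the empty subsequence of
      a one-vertex path.\<close>
    obtain v where "v \<in> V"
      using ne by blast
    then have "vpath [v] (with_proj \<lparr>pverts = V, parcs = r\<rparr>)"
      by (auto simp: vpath_def vwalk_def)
    with True show ?thesis
      unfolding dag_chain_def by (metis empty_set list_emb_Nil)
  next
    case False
    define p where "p = sorted_list_of_set C"
    have "finite C"
      using C fin finite_subset by blast
    then have p: "set p = C" "distinct p" "sorted_wrt (<) p"
      by (auto simp: p_def)
    have "sorted_wrt (\<lambda>u v. (u, v) \<in> r) p"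
      using p(3) by (rule sorted_wrt_mono_rel[rotated]) (use C p(1) in auto)
    then have "set (vwalk_arcs p) \<subseteq> r"
      by (rule vwalk_arcs_subset_if_sorted_wrt)
    then have "vpath p (with_proj \<lparr>pverts = V, parcs = r\<rparr>)"
      using p C False by (auto simp: vpath_def vwalk_def)
    then show ?thesis
      using p(1) unfolding dag_chain_def by blast
  qed
qed

text \<open>For transitive \<open>r\<close>, reachability between distinct vertices is adjacency,
  and arcs only lead from smaller to larger numbers.\<close>

lemma dag_antichain_pair_digraph:
  "dag_antichain \<lparr>pverts = V, parcs = r\<rparr> A \<longleftrightarrow> A \<subseteq> V \<and> (\<forall>u\<in>A. \<forall>v\<in>A. u < v \<longrightarrow> (u, v) \<notin> r)"
proof -
  interpret pair_fin_digraph "\<lparr>pverts = V, parcs = r\<rparr>"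
    using dag_pair_digraph by (simp add: dag_def)
  have "u \<rightarrow>\<^sup>*\<^bsub>with_proj \<lparr>pverts = V, parcs = r\<rparr>\<^esub> v \<longleftrightarrow> (u, v) \<in> r" if "u \<noteq> v" for u v
  proof
    assume "u \<rightarrow>\<^sup>*\<^bsub>with_proj \<lparr>pverts = V, parcs = r\<rparr>\<^esub> v"
    then have "(u, v) \<in> r\<^sup>*"
      using reachable_rtranclI by fastforce
    with that show "(u, v) \<in> r"
      by (simp add: rtrancl_eq_or_trancl trancl_id[OF tr])
  qed (auto intro: reachable_adjI)
  then show ?thesis
    unfolding dag_antichain_def using less by auto (metis linorder_neqE_nat)
qed

end

section \<open>The permutations\<close>

definition block3 :: "int list" where
  "block3 = [8, 9, 4, 5, 10, 0, 1, 6, 11, 7, 2, 3]"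

definition block2 :: "int list" where
  "block2 = [3, 4, 7, 8, 1, 2, 5, 6]"

text \<open>
  The positions below 12 carry the pattern \<open>block3\<close>, the positions \<open>8 i, \<dots>, 8 i + 7\<close> for
  \<open>i \<ge> 2\<close> carry the pattern \<open>block2\<close>. The positions 12 to 15 are not used.
\<close>

definition val :: "nat \<Rightarrow> int" where
  "val v = (if v < 12 then block3 ! v else block2 ! (v mod 8) - 8 * int (v div 8))"

definition block_part :: "nat set \<Rightarrow> nat \<Rightarrow> nat set" where
  "block_part L i = {v. v div 8 = i \<and> v mod 8 \<in> L}"

definition block_parts :: "nat \<Rightarrow> nat set \<Rightarrow> nat set list" where
  "block_parts j L = map (\<lambda>i. block_part L (i + 2)) [0..<j]"

lemma nth_block2_bounds:
  assumes "l < 8"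
  shows "1 \<le> block2 ! l" "block2 ! l \<le> 8"
proof -
  have "\<forall>l\<in>{..<8}. 1 \<le> block2 ! l \<and> block2 ! l \<le> 8"
    by code_simp
  then show "1 \<le> block2 ! l" "block2 ! l \<le> 8"
    using assms by auto
qed

lemma nth_block3_nonneg:
  assumes "l < 12"
  shows "0 \<le> block3 ! l"
proof -
  have "\<forall>l\<in>{..<12}. 0 \<le> block3 ! l"
    by code_simp
  then show ?thesis
    using assms by auto
qed

text \<open>For \<open>i \<ge> 2\<close> the values of block \<open>i\<close> lie between
  \<open>1 - 8 * i\<close> and \<open>8 - 8 * i\<close>. These intervals are disjoint, descend with
  \<open>i\<close> and are negative, whereas \<open>block3\<close> has no negative entry. Hence a
  rise never crosses between blocks.\<close>

lemma val_less_cases: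
  assumes "u < v" "val u < val v" "u < 12 \<or> 16 \<le> u" "v < 12 \<or> 16 \<le> v"
  obtains "v < 12" "block3 ! u < block3 ! v"
  | "16 \<le> u" "u div 8 = v div 8" "u mod 8 < v mod 8" "block2 ! (u mod 8) < block2 ! (v mod 8)"
proof -
  note bu = nth_block2_bounds[of "u mod 8", simplified]
  note bv = nth_block2_bounds[of "v mod 8", simplified]
  consider "v < 12" | "u < 12" "16 \<le> v" | "16 \<le> u"
    using assms by linarith
  then show thesis
  proof cases
    case 1
    then show ?thesis
      using assms that(1) by (auto simp: val_def)
  next
    case 2
    then have "2 \<le> v div 8"
      by simp
    then have "val v < 0"
      using 2 bv by (simp add: val_def)
    moreover have "0 \<le> val u"
      using 2 nth_block3_nonneg by (simp add: val_def)
    ultimately show ?thesis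
      using assms(2) by linarith
  next
    case 3
    have *: "block2 ! (u mod 8) - 8 * int (u div 8) < block2 ! (v mod 8) - 8 * int (v div 8)"
      using 3 assms(1,2) by (simp add: val_def)
    have "u div 8 \<le> v div 8"
      using assms(1) by (simp add: div_le_mono)
    moreover have "int (v div 8) < int (u div 8) + 1"
      using * bu bv by linarith
    ultimately have eq: "u div 8 = v div 8"
      by linarith
    have "u mod 8 < v mod 8"
      using eq assms(1) by (metis add_less_cancel_left mult_div_mod_eq)
    with 3 eq * show ?thesis
      by (intro that(2)) auto
  qed
qed

section \<open>Position sets inside the copies of the 8-point block\<close>

lemma block_part_eq_image:
  assumes "L \<subseteq> {..<8}"
  shows "block_part L i = (\<lambda>l. 8 * i + l) ` L"
proof
  show "block_part L i \<subseteq> (\<lambda>l. 8 * i + l) ` L"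
  proof
    fix v assume "v \<in> block_part L i"
    then show "v \<in> (\<lambda>l. 8 * i + l) ` L"
      by (intro image_eqI[of _ _ "v mod 8"]) (auto simp: block_part_def)
  qed
qed (use assms in \<open>auto simp: block_part_def\<close>)

lemma card_block_part: "L \<subseteq> {..<8} \<Longrightarrow> card (block_part L i) = card L"
  by (simp add: block_part_eq_image card_image)

lemma Union_block_parts:
  "\<Union>(set (block_parts j L)) = {v. v div 8 \<in> {2..<j + 2} \<and> v mod 8 \<in> L}"
proof
  show "{v. v div 8 \<in> {2..<j + 2} \<and> v mod 8 \<in> L} \<subseteq> \<Union>(set (block_parts j L))"
  proof
    fix v assume "v \<in> {v. v div 8 \<in> {2..<j + 2} \<and> v mod 8 \<in> L}"
    \<comment> \<open>The list index is \<open>v div 8 - 2\<close>; truncated subtraction is exact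
      here because \<open>v div 8\<close> is at least 2.\<close>
    then have "v \<in> block_part L (v div 8 - 2 + 2)" "v div 8 - 2 < j"
      by (auto simp: block_part_def)
    then show "v \<in> \<Union>(set (block_parts j L))"
      unfolding block_parts_def by (simp only: set_map set_upt) fastforce
  qed
qed (auto simp: block_parts_def block_part_def)

lemma length_block_parts: "length (block_parts j L) = j"
  by (simp add: block_parts_def)

lemma sorted_wrt_disjnt_block_parts: "sorted_wrt disjnt (block_parts j L)"
  by (auto simp: block_parts_def sorted_wrt_iff_nth_less block_part_def disjnt_iff)

lemma sum_list_card_block_parts:
  "L \<subseteq> {..<8} \<Longrightarrow> sum_list (map card (block_parts j L)) = j * card L"
  by (simp add: block_parts_def comp_def card_block_part sum_list_triv)

lemma strict_mono_on_block_part: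
  assumes "2 \<le> i" "\<forall>m\<in>L. \<forall>l\<in>L. l < m \<longrightarrow> block2 ! l < block2 ! m"
  shows "strict_mono_on (block_part L i) val"
proof (rule strict_mono_onI)
  fix u v assume uv: "u \<in> block_part L i" "v \<in> block_part L i" "u < v"
  then have eq: "u div 8 = i" "v div 8 = i" "u mod 8 \<in> L" "v mod 8 \<in> L"
    by (auto simp: block_part_def)
  then have "16 \<le> u"
    using assms(1) by linarith
  moreover have "u mod 8 < v mod 8"
    using eq uv(3) by (metis add_less_cancel_left mult_div_mod_eq)
  ultimately show "val u < val v"
    using uv(3) eq assms(2) by (auto simp: val_def)
qed

lemma strict_mono_on_block3:
  assumes "L \<subseteq> {..<12}" "\<forall>m\<in>L. \<forall>l\<in>L. l < m \<longrightarrow> block3 ! l < block3 ! m"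
  shows "strict_mono_on L val"
  using assms by (auto simp: strict_mono_on_def val_def subset_iff)

text \<open>Since rises stay inside one block, one rank table per pattern suffices:
  \<open>xs\<close> indexed by position in the 12-point block, \<open>ys\<close> by the residue
  modulo 8 and shared by all copies. With concrete \<open>A\<close> and \<open>B\<close> the
  conditions become finite checks.\<close>

lemma card_le_block_rank_bound:
  fixes xs ys :: "nat list"
  assumes "strict_mono_on S val" "S \<subseteq> U"
    and U: "U \<subseteq> A \<union> {v. 16 \<le> v \<and> v mod 8 \<in> B}" "A \<subseteq> {..<12}"
    and A: "\<forall>v\<in>A. xs ! v < h \<and> (\<forall>u\<in>A. u < v \<longrightarrow> block3 ! u < block3 ! v \<longrightarrow> xs ! u < xs ! v)"
    and B: "\<forall>v\<in>B. ys ! v < h \<and> (\<forall>u\<in>B. u < v \<longrightarrow> block2 ! u < block2 ! v \<longrightarrow> ys ! u < ys ! v)"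
  shows "card S \<le> h"
proof (rule card_le_rank_bound[OF assms(1,2)])
  let ?rk = "\<lambda>v. if v < 12 then xs ! v else ys ! (v mod 8)"
  have cases: "v \<in> A \<and> v < 12 \<or> 16 \<le> v \<and> v mod 8 \<in> B" if "v \<in> U" for v
    using U that by auto
  show "?rk v < h" if "v \<in> U" for v
    using cases[OF that] A B by auto
  show "?rk u < ?rk v" if uv: "u \<in> U" "v \<in> U" "u < v" "val u < val v" for u v
  proof -
    have "u < 12 \<or> 16 \<le> u" "v < 12 \<or> 16 \<le> v"
      using cases uv(1,2) by blast+
    with uv(3,4) show ?thesis
    proof (cases rule: val_less_cases)
      case 1
      then show ?thesis
        using cases[OF uv(1)] cases[OF uv(2)] uv(3) A by auto
    next
      case 2
      then show ?thesis
        using cases[OF uv(1)] cases[OF uv(2)] uv(3) B by auto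
    qed
  qed
qed

text \<open>Stated for increasing sets instead of a graph, so that the chain and the antichain half
  can share one point set and one run.\<close>

lemma greedy_increasing_bad:
  fixes k :: nat
  assumes "2 \<le> k"
  obtains V :: "nat set" and Ss
  where "finite V" "V \<noteq> {}" "length Ss = k"
    "greedy_run (\<lambda>S. S \<subseteq> V \<and> strict_mono_on S val) V Ss"
    "4 * card (\<Union>(set Ss)) \<le> 3 * max_disjoint_union (\<lambda>S. S \<subseteq> V \<and> strict_mono_on S val) k"
proof -
  \<comment> \<open>The 12-point block accounts for three steps and is present exactly for odd
    \<open>k\<close>; each of the \<open>j\<close> copies of the 8-point block accounts for
    two.\<close>
  define e where "e = odd k"
  define j where "j = (if e then (k - 3) div 2 else k div 2)"
  have k: "k = (if e then 3 else 0) + 2 * j"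
    using assms unfolding e_def j_def by auto presburger+
  define if_odd :: "nat set list \<Rightarrow> nat set list" where "if_odd Ss = (if e then Ss else [])" for Ss
  define V where "V = (if e then {..<12} else {}) \<union> {v. v div 8 \<in> {2..<j + 2}}"
  define P where "P = (\<lambda>S. S \<subseteq> V \<and> strict_mono_on S val)"
  \<comment> \<open>The sets consist of positions, not values. \<open>G1\<close>, \<open>G2\<close>
    and \<open>G3\<close> collect the selections of sizes 4, 3 and 2 from all blocks, so that the
    sizes descend along the run as greediness demands.\<close>
  define G1 where "G1 = if_odd [{5, 6, 7, 8}] @ block_parts j {0, 1, 6, 7}"
  define G2 where "G2 = if_odd [{2, 3, 4}]"
  define G3 where "G3 = if_odd [{0, 1}] @ block_parts j {2, 3}"
  define Opt where "Opt = if_odd [{0, 1, 4, 8}, {2, 3, 7, 9}, {5, 6, 10, 11}] @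
    block_parts j {0, 1, 2, 3} @ block_parts j {4, 5, 6, 7}"

  have V_bounds: "v < 12 \<and> e \<or> 16 \<le> v \<and> v div 8 \<in> {2..<j + 2}" if "v \<in> V" for v
  proof (cases "v < 16")
    case True
    then have "\<not> 2 \<le> v div 8"
      by linarith
    with that show ?thesis
      by (auto simp: V_def split: if_splits)
  next
    case False
    with that show ?thesis
      by (auto simp: V_def split: if_splits)
  qed
  have fin_V: "finite V"
  proof (rule finite_subset)
    show "V \<subseteq> {..<8 * j + 16}"
      using V_bounds by force
  qed simp
  have V_ne: "V \<noteq> {}"
  proof (cases e)
    case True
    then have "0 \<in> V"
      by (simp add: V_def)
    then show ?thesis
      by blast
  next
    case False
    then have "16 \<in> V"
      using k assms by (auto simp: V_def)
    then show ?thesis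
      by blast
  qed

  \<comment> \<open>Monotonicity, disjointness and sizes of the selected sets\<close>
  have P_parts: "\<forall>S\<in>set (block_parts j L). P S"
    if "\<forall>m\<in>L. \<forall>l\<in>L. l < m \<longrightarrow> block2 ! l < block2 ! m" for L
  proof
    fix S assume S: "S \<in> set (block_parts j L)"
    then obtain i where "S = block_part L i" "2 \<le> i"
      unfolding block_parts_def by fastforce
    moreover have "S \<subseteq> V"
      using S Union_block_parts[of j L] by (auto simp: V_def)
    ultimately show "P S"
      using strict_mono_on_block_part that by (simp add: P_def)
  qed
  have P_if_odd: "\<forall>S\<in>set (if_odd Ss). P S"
    if "\<forall>L\<in>set Ss. L \<subseteq> {..<12} \<and> (\<forall>m\<in>L. \<forall>l\<in>L. l < m \<longrightarrow> block3 ! l < block3 ! m)" for Ss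
    using that strict_mono_on_block3 by (auto simp: if_odd_def P_def V_def)
  have P_G1: "\<forall>S\<in>set G1. P S"
    unfolding G1_def set_append ball_Un by (intro conjI P_if_odd P_parts; code_simp)
  have P_G2: "\<forall>S\<in>set G2. P S"
    unfolding G2_def by (intro P_if_odd; code_simp)
  have P_G3: "\<forall>S\<in>set G3. P S"
    unfolding G3_def set_append ball_Un by (intro conjI P_if_odd P_parts; code_simp)
  have P_Opt: "\<forall>S\<in>set Opt. P S"
    unfolding Opt_def set_append ball_Un by (intro conjI P_if_odd P_parts; code_simp)

  have ge16: "16 \<le> v" if "S \<in> set (block_parts j L)" "v \<in> S" for v S L
    using that by (auto simp: block_parts_def block_part_def)
  have disj_block: "disjnt S T" if "S \<subseteq> {..<12}" "T \<in> set (block_parts j L)" for S T L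
    using that ge16 by (fastforce simp: disjnt_iff)
  have disj_blocks: "disjnt S T" if "S \<in> set (block_parts j L)" "T \<in> set (block_parts j M)"
    "L \<inter> M = {}" for S T L M
    using that by (auto simp: block_parts_def block_part_def disjnt_iff)
  have disj_G1: "sorted_wrt disjnt G1" and disj_G2: "sorted_wrt disjnt G2"
    and disj_G3: "sorted_wrt disjnt G3"
    by (auto simp: G1_def G2_def G3_def if_odd_def sorted_wrt_append sorted_wrt_disjnt_block_parts
        dest: ge16)
  have disj_Opt: "sorted_wrt disjnt Opt"
    by (auto simp: Opt_def if_odd_def sorted_wrt_append sorted_wrt_disjnt_block_parts
        intro: disj_blocks dest: ge16)

  have card_parts: "card S = card L" if "S \<in> set (block_parts j L)" "L \<subseteq> {..<8}" for S L
    using that by (auto simp: block_parts_def card_block_part)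
  have card_G1: "card S = 4" if "S \<in> set G1" for S
    using that card_parts[of S "{0, 1, 6, 7}"] by (auto simp: G1_def if_odd_def split: if_splits)
  have card_G2: "card S = 3" if "S \<in> set G2" for S
    using that by (auto simp: G2_def if_odd_def split: if_splits)
  have card_G3: "card S = 2" if "S \<in> set G3" for S
    using that card_parts[of S "{2, 3}"] by (auto simp: G3_def if_odd_def split: if_splits)

  \<comment> \<open>Uncovered points and their heights in the three phases\<close>
  define U2 where "U2 = V - \<Union>(set G1)"
  define U3 where "U3 = U2 - \<Union>(set G2)"
  \<comment> \<open>Explicit enumeration reduces the inclusions below to propositional case
    distinctions.\<close>
  have mod8: "v mod 8 \<in> {0, 1, 2, 3, 4, 5, 6, 7}" for v :: nat
    unfolding insert_iff empty_iff by presburger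
  have lt12: "v \<in> {0, 1, 2, 3, 4, 5, 6, 7, 8, 9, 10, 11}" if "v < 12" for v :: nat
    using that unfolding insert_iff empty_iff by presburger
  have V_sub: "V \<subseteq> {0, 1, 2, 3, 4, 5, 6, 7, 8, 9, 10, 11} \<union>
      {v. 16 \<le> v \<and> v mod 8 \<in> {0, 1, 2, 3, 4, 5, 6, 7}}"
    using V_bounds mod8 lt12 by blast
  have U2_sub: "U2 \<subseteq> {0, 1, 2, 3, 4, 9, 10, 11} \<union> {v. 16 \<le> v \<and> v mod 8 \<in> {2, 3, 4, 5}}"
  proof
    fix v assume "v \<in> U2"
    then have "v \<in> V" and "e \<longrightarrow> v \<notin> {5, 6, 7, 8}"
      and "v div 8 \<in> {2..<j + 2} \<longrightarrow> v mod 8 \<notin> {0, 1, 6, 7}"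
      using Union_block_parts[of j "{0, 1, 6, 7}"] by (auto simp: U2_def G1_def if_odd_def)
    with V_bounds[of v] mod8[of v] lt12[of v]
    show "v \<in> {0, 1, 2, 3, 4, 9, 10, 11} \<union> {v. 16 \<le> v \<and> v mod 8 \<in> {2, 3, 4, 5}}"
      unfolding Un_iff mem_Collect_eq insert_iff empty_iff by argo
  qed
  \<comment> \<open>The residues are the same as for \<open>U2\<close>, because \<open>G2\<close>
    takes nothing from the 8-point blocks.\<close>
  have U3_sub: "U3 \<subseteq> {0, 1, 9, 10, 11} \<union> {v. 16 \<le> v \<and> v mod 8 \<in> {2, 3, 4, 5}}"
  proof
    fix v assume v: "v \<in> U3"
    then have "v \<in> V" "v \<in> U2" and "e \<longrightarrow> v \<notin> {2, 3, 4}"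
      by (auto simp: U2_def U3_def G2_def if_odd_def)
    with V_bounds[of v] U2_sub
    show "v \<in> {0, 1, 9, 10, 11} \<union> {v. 16 \<le> v \<and> v mod 8 \<in> {2, 3, 4, 5}}"
      by auto
  qed

  text \<open>The lists are the ranks in the poset of what is left; the zeros at removed positions are
    dummies.\<close>
  have height_V: "card S \<le> 4" if "P S" "S \<subseteq> V" for S
  proof (rule card_le_block_rank_bound[OF _ that(2) V_sub,
        of "[0, 1, 0, 1, 2, 0, 1, 2, 3, 3, 2, 3]" 4 "[0, 1, 2, 3, 0, 1, 2, 3]"])
    show "strict_mono_on S val"
      using that by (simp add: P_def)
  qed code_simp+
  have height_U2: "card S \<le> 3" if "P S" "S \<subseteq> U2" for S
  proof (rule card_le_block_rank_bound[OF _ that(2) U2_sub,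
        of "[0, 1, 0, 1, 2, 0, 0, 0, 0, 2, 0, 1]" 3 "[0, 0, 0, 1, 0, 1]"])
    show "strict_mono_on S val"
      using that by (simp add: P_def)
  qed code_simp+
  have height_U3: "card S \<le> 2" if "P S" "S \<subseteq> U3" for S
  proof (rule card_le_block_rank_bound[OF _ that(2) U3_sub,
        of "[0, 1, 0, 0, 0, 0, 0, 0, 0, 0, 0, 1]" 2 "[0, 0, 0, 1, 0, 1]"])
    show "strict_mono_on S val"
      using that by (simp add: P_def)
  qed code_simp+

  have G2_U2: "S \<subseteq> U2" if "S \<in> set G2" for S
  proof -
    have "S = {2, 3, 4}" "e"
      using that by (auto simp: G2_def if_odd_def split: if_splits)
    then show ?thesis
      using Union_block_parts[of j "{0, 1, 6, 7}"] by (auto simp: U2_def G1_def if_odd_def V_def)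
  qed
  have G3_U3: "S \<subseteq> U3" if "S \<in> set G3" for S
  proof -
    have "S \<subseteq> V"
      using P_G3 that by (auto simp: P_def)
    moreover have "disjnt S T" if "T \<in> set G1 \<union> set G2" for T
      using that \<open>S \<in> set G3\<close> disj_blocks[of S "{2, 3}" T "{0, 1, 6, 7}"]
        disj_block[of "{0, 1}" T "{0, 1, 6, 7}"] disj_block[of T S "{2, 3}"]
      by (auto simp: G1_def G2_def G3_def if_odd_def disjnt_sym split: if_splits)
    ultimately show ?thesis
      by (fastforce simp: U3_def U2_def disjnt_iff)
  qed

  \<comment> \<open>The run is assembled from its last phase backwards, as
    \<open>greedy_run_append\<close> expects a run on what its phase leaves over.\<close>
  have run3: "greedy_run P U3 (G3 @ [])"
    by (rule greedy_run_append[where h = 2])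
      (use disj_G3 P_G3 card_G3 G3_U3 height_U3 in \<open>auto intro: greedy_run.intros\<close>)
  have run2: "greedy_run P U2 (G2 @ G3)"
    by (rule greedy_run_append[where h = 3])
      (use run3 disj_G2 P_G2 card_G2 G2_U2 height_U2 in \<open>auto simp: U3_def\<close>)
  have "greedy_run P V (G1 @ G2 @ G3)"
    by (rule greedy_run_append[where h = 4])
      (use run2 disj_G1 P_G1 card_G1 height_V in \<open>auto simp: U2_def P_def\<close>)

  moreover have "length (G1 @ G2 @ G3) = k"
    by (simp add: k G1_def G2_def G3_def if_odd_def length_block_parts)

  moreover have "4 * card (\<Union>(set (G1 @ G2 @ G3))) \<le> 3 * max_disjoint_union P k"
  proof -
    have fin: "finite S" if "P S" for S
      using that fin_V finite_subset by (auto simp: P_def)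
    have "card (\<Union>(set (G1 @ G2 @ G3))) \<le>
        card (\<Union>(set G1)) + (card (\<Union>(set G2)) + card (\<Union>(set G3)))"
      by (simp add: Un_assoc) (meson card_Un_le add_left_mono order_trans)
    also have "\<dots> = sum_list (map card G1) + (sum_list (map card G2) + sum_list (map card G3))"
      using disj_G1 disj_G2 disj_G3 P_G1 P_G2 P_G3 fin by (simp add: card_Union_sorted_wrt_disjnt)
    \<comment> \<open>The 12-point block contributes 4 + 3 + 2 and each 8-point block 4 + 2, which
      is three quarters of its points in either case.\<close>
    also have "\<dots> = (if e then 9 else 0) + 6 * j"
      by (simp add: G1_def G2_def G3_def if_odd_def sum_list_card_block_parts)
    finally have "4 * card (\<Union>(set (G1 @ G2 @ G3))) \<le> 3 * ((if e then 12 else 0) + 8 * j)"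
      by auto
    also have "(if e then 12 else 0) + 8 * j = sum_list (map card Opt)"
      by (simp add: Opt_def if_odd_def sum_list_card_block_parts)
    also have "\<dots> = card (\<Union>(set Opt))"
      using disj_Opt P_Opt fin by (simp add: card_Union_sorted_wrt_disjnt)
    also have "\<dots> \<le> max_disjoint_union P k"
    proof (rule card_Union_le_max_disjoint_union[OF fin_V _ disj_Opt])
      show "length Opt = k"
        by (simp add: k Opt_def if_odd_def length_block_parts)
    qed (use P_Opt in \<open>auto simp: P_def\<close>)
    finally show ?thesis
      by simp
  qed
  ultimately show thesis
    using that[OF fin_V V_ne] unfolding P_def by blast
qed

section \<open>Transfer to the two DAGs\<close>

theorem theorem4:
  shows "(\<forall>k::nat. k \<ge> 2 \<longrightarrow>
            (\<exists>(G :: nat pair_pre_digraph) Cs. dag G \<and> greedy_chain_run G k Cs \<and>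
               real (card (\<Union>(set Cs))) \<le> 3 / 4 * real (beta G k))) \<and>
         (\<forall>k::nat. k \<ge> 2 \<longrightarrow>
            (\<exists>(G :: nat pair_pre_digraph) As. dag G \<and> greedy_antichain_run G k As \<and>
               real (card (\<Union>(set As))) \<le> 3 / 4 * real (alpha G k)))"
proof (intro conjI allI impI)
  fix k :: nat assume "2 \<le> k"
  then obtain V Ss where V: "finite V" "V \<noteq> {}" and Ss: "length Ss = k"
    "greedy_run (\<lambda>S. S \<subseteq> V \<and> strict_mono_on S val) V Ss"
    "4 * card (\<Union>(set Ss)) \<le> 3 * max_disjoint_union (\<lambda>S. S \<subseteq> V \<and> strict_mono_on S val) k"
    by (rule greedy_increasing_bad)
  define r where "r = {(u, v). u \<in> V \<and> v \<in> V \<and> u < v \<and> val u < val v}"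
  define G where "G = \<lparr>pverts = V, parcs = r\<rparr>"
  have r: "r \<subseteq> V \<times> V" "\<And>u v. (u, v) \<in> r \<Longrightarrow> u < v" "trans r"
    by (auto simp: r_def trans_def)
  have "dag_chain G = (\<lambda>S. S \<subseteq> V \<and> strict_mono_on S val)"
  proof
    fix S
    show "dag_chain G S \<longleftrightarrow> S \<subseteq> V \<and> strict_mono_on S val"
      using dag_chain_pair_digraph[OF V r, of S, folded G_def]
      by (auto simp: r_def strict_mono_on_def subset_iff)
  qed
  then have "greedy_chain_run G k Ss" "4 * card (\<Union>(set Ss)) \<le> 3 * beta G k"
    using Ss by (simp_all add: greedy_chain_run_def beta_def G_def)
  moreover have "dag G"
    unfolding G_def by (rule dag_pair_digraph[OF V r])
  ultimately show "\<exists>(G :: nat pair_pre_digraph) Cs. dag G \<and> greedy_chain_run G k Cs \<and>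
      real (card (\<Union>(set Cs))) \<le> 3 / 4 * real (beta G k)"
    by (intro exI[of _ G] exI[of _ Ss]) auto

  \<comment> \<open>The condition amounts to \<open>val v \<le> val u\<close>, which is transitive
    and exactly complementary to the one in \<open>r\<close>. Hence the antichains of
    \<open>G'\<close> are the chains of \<open>G\<close>, and the same run \<open>Ss\<close> serves
    again.\<close>
  define r' where "r' = {(u, v). u \<in> V \<and> v \<in> V \<and> u < v \<and> \<not> val u < val v}"
  define G' where "G' = \<lparr>pverts = V, parcs = r'\<rparr>"
  have r': "r' \<subseteq> V \<times> V" "\<And>u v. (u, v) \<in> r' \<Longrightarrow> u < v" "trans r'"
    by (auto simp: r'_def trans_def)
  have "dag_antichain G' = (\<lambda>S. S \<subseteq> V \<and> strict_mono_on S val)"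
  proof
    fix S
    show "dag_antichain G' S \<longleftrightarrow> S \<subseteq> V \<and> strict_mono_on S val"
      using dag_antichain_pair_digraph[OF V r', of S, folded G'_def]
      by (auto simp: r'_def strict_mono_on_def subset_iff)
  qed
  then have "greedy_antichain_run G' k Ss" "4 * card (\<Union>(set Ss)) \<le> 3 * alpha G' k"
    using Ss by (simp_all add: greedy_antichain_run_def alpha_def G'_def)
  moreover have "dag G'"
    unfolding G'_def by (rule dag_pair_digraph[OF V r'])
  ultimately show "\<exists>(G :: nat pair_pre_digraph) As. dag G \<and> greedy_antichain_run G k As \<and>
      real (card (\<Union>(set As))) \<le> 3 / 4 * real (alpha G k)"
    by (intro exI[of _ G'] exI[of _ Ss]) auto
qed

end
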